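(* Let $\mathcal{F}$ be a free filter on a countably infinite set $N$ with the double Schur property. Then $\mathcal{F}$ is both weak $\ell_1$ complete and a Schur filter.
   Context: A filter on $N$ is free if it contains all subsets of $N$ with finite complement. A family $(x_n)_{n\in N}$ in a topological space $\mathcal{F}$-converges to $x$ if $\{n\in N: x_n\in U\}\in\mathcal{F}$ for every neighborhood $U$ of $x$. The space $\ell_1$ is the real Banach space of absolutely summable sequences, regarded as a subspace of its bidual $\ell_1^{**}$ via the canonical embedding. A free filter $\mathcal{G}$ on a countably infinite set $M$ is a Schur filter (has the Schur property) if for every family $(x_m)_{m\in M}\subset\ell_1$ that $\mathcal{G}$-converges to $0$ in the weak topology of $\ell_1$, one has $\mathcal{G}\text{-}\lim\|x_m\|=0$. For filters $\mathcal{F}_1$ on $N_1$ and $\mathcal{F}_2$ on $N_2$, the filter $\mathcal{F}_1\times\mathcal{F}_2$ on $N_1\times N_2$ is the filter with base $\{A_1\times A_2: A_1\in\mathcal{F}_1, A_2\in\mathcal{F}_2\}$. A filter $\mathcal{F}$ on $N$ has the double Schur property if $\mathcal{F}\times\mathcal{F}$ is a Schur filter (on $N\times N$). A filter $\mathcal{F}$ on $N$ is weak $\ell_1$ complete (a WC1-filter) if for every norm-bounded family $(x_n)_{n\in N}\subset\ell_1$ that $\mathcal{F}$-converges in the topology $\sigma(\ell_1^{**},\ell_1^{*})$ to some $x\in\ell_1^{**}$, the limit $x$ in fact belongs to $\ell_1$. *)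

theory Defs
  imports "HOL-Analysis.Analysis"
begin

section \<open>The Banach space of absolutely summable real sequences\<close>

typedef ell1 = "{x :: nat \<Rightarrow> real. summable (\<lambda>k. \<bar>x k\<bar>)}"
  morphisms ell1_nth Abs_ell1
  by (rule exI[of _ "\<lambda>_. 0"]) simp

setup_lifting type_definition_ell1

lemma summable_ell1: "summable (\<lambda>k. \<bar>ell1_nth x k\<bar>)"
  using ell1_nth[of x] by simp

instantiation ell1 :: real_vector
begin

lift_definition zero_ell1 :: ell1 is "\<lambda>_. 0"
  by simp

lift_definition plus_ell1 :: "ell1 \<Rightarrow> ell1 \<Rightarrow> ell1" is "\<lambda>x y k. x k + y k"
proof -
  fix x y :: "nat \<Rightarrow> real"
  assume "summable (\<lambda>k. \<bar>x k\<bar>)" "summable (\<lambda>k. \<bar>y k\<bar>)"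
  then have "summable (\<lambda>k. \<bar>x k\<bar> + \<bar>y k\<bar>)"
    by (rule summable_add)
  then show "summable (\<lambda>k. \<bar>x k + y k\<bar>)"
    by (rule summable_comparison_test[rotated]) auto
qed

lift_definition uminus_ell1 :: "ell1 \<Rightarrow> ell1" is "\<lambda>x k. - x k"
  by simp

lift_definition minus_ell1 :: "ell1 \<Rightarrow> ell1 \<Rightarrow> ell1" is "\<lambda>x y k. x k - y k"
proof -
  fix x y :: "nat \<Rightarrow> real"
  assume "summable (\<lambda>k. \<bar>x k\<bar>)" "summable (\<lambda>k. \<bar>y k\<bar>)"
  then have "summable (\<lambda>k. \<bar>x k\<bar> + \<bar>y k\<bar>)"
    by (rule summable_add)
  then show "summable (\<lambda>k. \<bar>x k - y k\<bar>)"
    by (rule summable_comparison_test[rotated]) auto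
qed

lift_definition scaleR_ell1 :: "real \<Rightarrow> ell1 \<Rightarrow> ell1" is "\<lambda>c x k. c * x k"
  by (simp add: abs_mult summable_mult)

instance
  by standard (transfer; simp add: fun_eq_iff algebra_simps)+

end

lemmas ell1_nth_simps [simp] =
  zero_ell1.rep_eq plus_ell1.rep_eq uminus_ell1.rep_eq minus_ell1.rep_eq scaleR_ell1.rep_eq

instantiation ell1 :: real_normed_vector
begin

definition norm_ell1 :: "ell1 \<Rightarrow> real" where
  "norm_ell1 x = (\<Sum>k. \<bar>ell1_nth x k\<bar>)"

definition dist_ell1 :: "ell1 \<Rightarrow> ell1 \<Rightarrow> real" where
  "dist_ell1 x y = norm (x - y)"

definition sgn_ell1 :: "ell1 \<Rightarrow> ell1" where
  "sgn_ell1 x = x /\<^sub>R norm x"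

definition uniformity_ell1 :: "(ell1 \<times> ell1) filter" where
  "uniformity_ell1 = (INF e\<in>{0<..}. principal {(x, y). dist x y < e})"

definition open_ell1 :: "ell1 set \<Rightarrow> bool" where
  "open_ell1 U = (\<forall>x\<in>U. \<forall>\<^sub>F (x', y) in uniformity. x' = x \<longrightarrow> y \<in> U)"

instance
proof
  fix x y :: ell1 and c :: real
  show "norm x = 0 \<longleftrightarrow> x = 0"
  proof -
    have "norm x = 0 \<longleftrightarrow> (\<forall>k. \<bar>ell1_nth x k\<bar> = 0)"
      unfolding norm_ell1_def by (rule suminf_eq_zero_iff[OF summable_ell1]) simp
    also have "\<dots> \<longleftrightarrow> x = 0"
      by (auto simp: ell1_nth_inject[symmetric] fun_eq_iff)
    finally show ?thesis .
  qed
  show "norm (x + y) \<le> norm x + norm y"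
    unfolding norm_ell1_def
    by (subst suminf_add[OF summable_ell1 summable_ell1])
      (intro suminf_le summable_ell1 summable_add, auto)
  show "norm (c *\<^sub>R x) = \<bar>c\<bar> * norm x"
    unfolding norm_ell1_def
    by (simp add: abs_mult suminf_mult[OF summable_ell1])
qed (auto simp: dist_ell1_def sgn_ell1_def uniformity_ell1_def open_ell1_def)

end

lemma sum_abs_ell1_le_norm: "(\<Sum>k<K. \<bar>ell1_nth x k\<bar>) \<le> norm x"
  unfolding norm_ell1_def by (rule sum_le_suminf[OF summable_ell1]) auto

lemma abs_ell1_nth_le_norm: "\<bar>ell1_nth x k\<bar> \<le> norm x"
proof -
  have "\<bar>ell1_nth x k\<bar> \<le> (\<Sum>i<Suc k. \<bar>ell1_nth x i\<bar>)"
    by (simp add: sum_nonneg)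
  then show ?thesis
    using sum_abs_ell1_le_norm[of x "Suc k"] by linarith
qed

instance ell1 :: banach
proof
  fix X :: "nat \<Rightarrow> ell1"
  assume X: "Cauchy X"
  have "Cauchy (\<lambda>n. ell1_nth (X n) k)" for k
  proof (rule metric_CauchyI)
    fix e :: real
    assume "e > 0"
    then obtain M where M: "\<And>m n. m \<ge> M \<Longrightarrow> n \<ge> M \<Longrightarrow> dist (X m) (X n) < e"
      using metric_CauchyD[OF X] by blast
    have "dist (ell1_nth (X m) k) (ell1_nth (X n) k) < e" if "m \<ge> M" "n \<ge> M" for m n
      using abs_ell1_nth_le_norm[of "X m - X n" k] M[OF that]
      by (simp add: dist_norm)
    then show "\<exists>M. \<forall>m\<ge>M. \<forall>n\<ge>M. dist (ell1_nth (X m) k) (ell1_nth (X n) k) < e"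
      by blast
  qed
  then have "\<forall>k. \<exists>l. (\<lambda>n. ell1_nth (X n) k) \<longlonglongrightarrow> l"
    using Cauchy_convergent convergent_def by blast
  then obtain y where y: "\<And>k. (\<lambda>n. ell1_nth (X n) k) \<longlonglongrightarrow> y k"
    by metis
  have bound: "\<exists>M. \<forall>m\<ge>M. \<forall>K. (\<Sum>k<K. \<bar>ell1_nth (X m) k - y k\<bar>) \<le> e" if "e > 0" for e
  proof -
    obtain M where M: "\<And>m n. m \<ge> M \<Longrightarrow> n \<ge> M \<Longrightarrow> dist (X m) (X n) < e"
      using metric_CauchyD[OF X \<open>e > 0\<close>] by blast
    have "(\<Sum>k<K. \<bar>ell1_nth (X m) k - y k\<bar>) \<le> e" if "m \<ge> M" for m K
    proof (rule tendsto_upperbound)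
      show "(\<lambda>n. \<Sum>k<K. \<bar>ell1_nth (X m) k - ell1_nth (X n) k\<bar>)
              \<longlonglongrightarrow> (\<Sum>k<K. \<bar>ell1_nth (X m) k - y k\<bar>)"
        by (intro tendsto_intros y)
      have "(\<Sum>k<K. \<bar>ell1_nth (X m) k - ell1_nth (X n) k\<bar>) \<le> e" if "n \<ge> M" for n
        using sum_abs_ell1_le_norm[of "X m - X n" K] M[OF \<open>m \<ge> M\<close> that]
        by (simp add: dist_norm)
      then show "\<forall>\<^sub>F n in sequentially. (\<Sum>k<K. \<bar>ell1_nth (X m) k - ell1_nth (X n) k\<bar>) \<le> e"
        by (rule eventually_sequentiallyI)
    qed simp
    then show ?thesis by blast
  qed
  have diff: "summable (\<lambda>k. \<bar>ell1_nth (X m) k - y k\<bar>)"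
    if "\<forall>K. (\<Sum>k<K. \<bar>ell1_nth (X m) k - y k\<bar>) \<le> e" for m e
    using that by (intro summableI_nonneg_bounded[where x = e]) auto
  obtain M where M: "\<forall>m\<ge>M. \<forall>K. (\<Sum>k<K. \<bar>ell1_nth (X m) k - y k\<bar>) \<le> 1"
    using bound[of 1] by auto
  have "summable (\<lambda>k. \<bar>ell1_nth (X M) k\<bar> + \<bar>ell1_nth (X M) k - y k\<bar>)"
    using M by (intro summable_add summable_ell1 diff) auto
  then have "summable (\<lambda>k. \<bar>y k\<bar>)"
    by (rule summable_comparison_test[rotated]) (auto intro!: exI[of _ 0])
  then have Y: "ell1_nth (Abs_ell1 y) = y"
    by (simp add: Abs_ell1_inverse)
  have "X \<longlonglongrightarrow> Abs_ell1 y"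
  proof (rule metric_LIMSEQ_I)
    fix r :: real
    assume "r > 0"
    then obtain M where M: "\<forall>m\<ge>M. \<forall>K. (\<Sum>k<K. \<bar>ell1_nth (X m) k - y k\<bar>) \<le> r / 2"
      using bound[of "r / 2"] by auto
    have "dist (X m) (Abs_ell1 y) < r" if "m \<ge> M" for m
    proof -
      have "norm (X m - Abs_ell1 y) \<le> r / 2"
        unfolding norm_ell1_def
        using M that by (intro suminf_le_const summable_ell1) (auto simp: Y)
      then show ?thesis
        using \<open>r > 0\<close> by (simp add: dist_norm)
    qed
    then show "\<exists>no. \<forall>n\<ge>no. dist (X n) (Abs_ell1 y) < r"
      by blast
  qed
  then show "convergent X"
    by (rule convergentI)
qed

section \<open>Weak topologies and the canonical embedding into the bidual\<close>

text \<open>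
  The dual of a normed space \<open>X\<close> is the type of bounded linear functionals on \<open>X\<close>.
  The type of functions from the dual to the reals carries the product topology, so the following
  is the initial topology of all the functionals, i.e. the weak topology of \<open>X\<close>.
\<close>

definition weak_topology :: "'a::real_normed_vector topology" where
  "weak_topology = pullback_topology UNIV (\<lambda>x (\<phi> :: 'a \<Rightarrow>\<^sub>L real). blinfun_apply \<phi> x) euclidean"

text \<open>
  The topology of pointwise convergence on the dual of a normed space \<open>Y\<close> is its weak-star topology;
  for \<open>Y\<close> the dual of \<open>X\<close>, it is the topology of the bidual of \<open>X\<close> induced by the dual of \<open>X\<close>.
\<close>

abbreviation weak_star_topology :: "('b::real_normed_vector \<Rightarrow>\<^sub>L real) topology" where
  "weak_star_topology \<equiv> strong_operator_topology"

definition bidual_embed :: "'a::real_normed_vector \<Rightarrow> (('a \<Rightarrow>\<^sub>L real) \<Rightarrow>\<^sub>L real)" where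
  "bidual_embed x = Blinfun (\<lambda>\<phi>. blinfun_apply \<phi> x)"

lemma bidual_embed_apply [simp]: "blinfun_apply (bidual_embed x) \<phi> = blinfun_apply \<phi> x"
  unfolding bidual_embed_def
  by (simp add: bounded_linear_Blinfun_apply blinfun.bounded_linear_left)

section \<open>Filters on a set and Schur-type properties\<close>

text \<open>
  A filter on the set \<open>N\<close> is proper and contains \<open>N\<close>; a subset \<open>A\<close> of \<open>N\<close> belongs to it iff
  eventually \<open>n \<in> A\<close>. Thus the values of a family outside \<open>N\<close> do not affect its convergence.
\<close>

definition filter_on :: "'a set \<Rightarrow> 'a filter \<Rightarrow> bool" where
  "filter_on N F \<longleftrightarrow> F \<noteq> bot \<and> (\<forall>\<^sub>F n in F. n \<in> N)"

definition free_filter_on :: "'a set \<Rightarrow> 'a filter \<Rightarrow> bool" where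
  "free_filter_on N F \<longleftrightarrow>
     filter_on N F \<and> (\<forall>A. A \<subseteq> N \<and> finite (N - A) \<longrightarrow> (\<forall>\<^sub>F n in F. n \<in> A))"

definition schur_filter :: "'a set \<Rightarrow> 'a filter \<Rightarrow> bool" where
  "schur_filter M G \<longleftrightarrow>
     countable M \<and> infinite M \<and> free_filter_on M G \<and>
     (\<forall>x :: 'a \<Rightarrow> ell1. limitin weak_topology x 0 G \<longrightarrow> ((\<lambda>m. norm (x m)) \<longlongrightarrow> 0) G)"

definition double_schur_filter :: "'a set \<Rightarrow> 'a filter \<Rightarrow> bool" where
  "double_schur_filter N F \<longleftrightarrow> schur_filter (N \<times> N) (F \<times>\<^sub>F F)"

definition weak_ell1_complete_filter :: "'a set \<Rightarrow> 'a filter \<Rightarrow> bool" where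
  "weak_ell1_complete_filter N F \<longleftrightarrow>
     filter_on N F \<and>
     (\<forall>(x :: 'a \<Rightarrow> ell1) (\<xi> :: (ell1 \<Rightarrow>\<^sub>L real) \<Rightarrow>\<^sub>L real).
        bounded (x ` N) \<and> limitin weak_star_topology (\<lambda>n. bidual_embed (x n)) \<xi> F
          \<longrightarrow> \<xi> \<in> range bidual_embed)"

end

theory Submission
  imports Defs
begin

text \<open>
  If \<open>x\<close> is weak-star convergent along \<open>F\<close>, then \<open>x m - x n\<close> is weakly null along \<open>F \<times>\<^sub>F F\<close>. By the
  double Schur property it is null in norm, so \<open>x\<close> is Cauchy in norm along \<open>F\<close>, and its norm limit
  is the weak-star limit. For the Schur property, regard a family on \<open>N\<close> as a family on \<open>N \<times> N\<close>
  that depends only on the first coordinate.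
\<close>

text \<open>The open sets of the pullback are exactly the preimages of open sets under
  \<open>g\<close>, so both sides test the same neighborhoods. The weak and the weak-star topology
  are both such pullbacks, which reduces their convergence to testing on each functional or
  vector.\<close>

lemma limitin_pullback_topology_UNIV:
  "limitin (pullback_topology UNIV g T) f l F \<longleftrightarrow> limitin T (\<lambda>a. g (f a)) (g l) F"
proof
  assume L: "limitin (pullback_topology UNIV g T) f l F"
  show "limitin T (\<lambda>a. g (f a)) (g l) F"
    unfolding limitin_def
  proof (intro conjI allI impI)
    show "g l \<in> topspace T"
      using limitin_topspace[OF L] by (simp add: topspace_pullback_topology)
  next
    fix U assume "openin T U \<and> g l \<in> U"
    then have "openin (pullback_topology UNIV g T) (g -` U)" "l \<in> g -` U"
      by (auto simp: openin_pullback_topology)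
    then show "\<forall>\<^sub>F a in F. g (f a) \<in> U"
      using L by (fastforce simp: limitin_def)
  qed
next
  assume "limitin T (\<lambda>a. g (f a)) (g l) F"
  then show "limitin (pullback_topology UNIV g T) f l F"
    by (auto simp: limitin_def topspace_pullback_topology openin_pullback_topology)
qed

lemma limitin_euclidean_fun:
  fixes f :: "'a \<Rightarrow> 'i \<Rightarrow> 'b::topological_space"
  shows "limitin euclidean f l F \<longleftrightarrow> (\<forall>i. ((\<lambda>a. f a i) \<longlongrightarrow> l i) F)"
  unfolding euclidean_product_topology[symmetric] limitin_componentwise by simp

lemma limitin_weak_topology:
  fixes x :: "'a \<Rightarrow> 'b::real_normed_vector"
  shows "limitin weak_topology x l F \<longleftrightarrow>
    (\<forall>\<phi> :: 'b \<Rightarrow>\<^sub>L real. ((\<lambda>a. blinfun_apply \<phi> (x a)) \<longlongrightarrow> blinfun_apply \<phi> l) F)"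
  unfolding weak_topology_def limitin_pullback_topology_UNIV limitin_euclidean_fun ..

lemma limitin_strong_operator_topology:
  "limitin strong_operator_topology f l F \<longleftrightarrow>
    (\<forall>y. ((\<lambda>a. blinfun_apply (f a) y) \<longlongrightarrow> blinfun_apply l y) F)"
  unfolding strong_operator_topology_def limitin_pullback_topology_UNIV limitin_euclidean_fun ..

text \<open>The form in which the double Schur property is applied below: weak nullity is tested
  functional by functional, with every functional vanishing at 0.\<close>

lemma double_schur_filter_tendsto_norm:
  fixes x :: "'a \<times> 'a \<Rightarrow> ell1"
  assumes "double_schur_filter N F"
    and "\<And>\<phi> :: ell1 \<Rightarrow>\<^sub>L real. ((\<lambda>p. blinfun_apply \<phi> (x p)) \<longlongrightarrow> 0) (F \<times>\<^sub>F F)"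
  shows "((\<lambda>p. norm (x p)) \<longlongrightarrow> 0) (F \<times>\<^sub>F F)"
  using assms
  by (simp add: double_schur_filter_def schur_filter_def limitin_weak_topology blinfun.zero_right)

lemma tendsto_fst_prod_filter:
  "(f \<longlongrightarrow> l) F \<Longrightarrow> ((\<lambda>p. f (fst p)) \<longlongrightarrow> l) (F \<times>\<^sub>F G)"
  by (rule filterlim_compose[OF _ filterlim_fst])

lemma tendsto_snd_prod_filter:
  "(f \<longlongrightarrow> l) G \<Longrightarrow> ((\<lambda>p. f (snd p)) \<longlongrightarrow> l) (F \<times>\<^sub>F G)"
  by (rule filterlim_compose[OF _ filterlim_snd])

lemma double_schur_imp_schur:
  assumes "countable N" "infinite N" "free_filter_on N F" "double_schur_filter N F"
  shows "schur_filter N F"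
  unfolding schur_filter_def
proof (intro conjI allI impI assms)
  fix x :: "'a \<Rightarrow> ell1"
  assume "limitin weak_topology x 0 F"
  then have "((\<lambda>p. norm (x (fst p))) \<longlongrightarrow> 0) (F \<times>\<^sub>F F)"
    by (intro double_schur_filter_tendsto_norm[OF assms(4)] tendsto_fst_prod_filter)
      (simp add: limitin_weak_topology blinfun.zero_right)
  moreover have "F \<noteq> bot"
    using assms(3) by (simp add: free_filter_on_def filter_on_def)
  ultimately show "((\<lambda>n. norm (x n)) \<longlongrightarrow> 0) F"
    \<comment> \<open>The event \<open>norm (x n) < e\<close> depends on the first coordinate alone.
      As the second factor \<open>F\<close> is proper, such an event holds eventually along the
      product iff it does along \<open>F\<close>.\<close>
    by (simp add: tendsto_iff
        eventually_prod1[where P = "\<lambda>n. norm (x n) < _", unfolded case_prod_beta])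
qed

text \<open>Smallness of the distance along the product filter gives members of \<open>F\<close>
  with images of arbitrarily small diameter. The image filter is thus Cauchy, and completeness of
  the space provides the limit.\<close>

lemma tendsto_if_dist_prod_tendsto_0:
  fixes x :: "'a \<Rightarrow> 'b::complete_space"
  assumes "F \<noteq> bot" and "((\<lambda>p. dist (x (fst p)) (x (snd p))) \<longlongrightarrow> 0) (F \<times>\<^sub>F F)"
  obtains l where "(x \<longlongrightarrow> l) F"
proof -
  have "cauchy_filter (filtermap x F)"
    unfolding cauchy_filter_metric_filtermap
  proof (intro allI impI)
    fix e :: real
    assume "e > 0"
    then have "\<forall>\<^sub>F p in F \<times>\<^sub>F F. dist (x (fst p)) (x (snd p)) < e"
      using assms(2) by (simp add: tendsto_iff)
    then show "\<exists>P. eventually P F \<and> (\<forall>a b. P a \<and> P b \<longrightarrow> dist (x a) (x b) < e)"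
      \<comment> \<open>Both factors are the same filter, so one predicate \<open>P\<close> can
        serve for both coordinates.\<close>
      by (auto simp: eventually_prod_same)
  qed
  then have "\<exists>l. filtermap x F \<le> nhds l"
    by (rule cauchy_filter_complete_converges[OF _ complete_UNIV])
      (use assms(1) in \<open>auto simp: filtermap_bot_iff\<close>)
  then show thesis
    using that by (auto simp: filterlim_def)
qed

lemma double_schur_imp_weak_ell1_complete:
  assumes "filter_on N F" "double_schur_filter N F"
  shows "weak_ell1_complete_filter N F"
  unfolding weak_ell1_complete_filter_def
proof (intro conjI allI impI assms)
  fix x :: "'a \<Rightarrow> ell1" and \<xi> :: "(ell1 \<Rightarrow>\<^sub>L real) \<Rightarrow>\<^sub>L real"
  assume "bounded (x ` N) \<and> limitin weak_star_topology (\<lambda>n. bidual_embed (x n)) \<xi> F"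
  then have \<xi>: "((\<lambda>n. blinfun_apply \<phi> (x n)) \<longlongrightarrow> blinfun_apply \<xi> \<phi>) F" for \<phi>
    by (simp add: limitin_strong_operator_topology)
  have F: "F \<noteq> bot"
    using assms(1) by (simp add: filter_on_def)
  have "((\<lambda>p. norm (x (fst p) - x (snd p))) \<longlongrightarrow> 0) (F \<times>\<^sub>F F)"
  proof (rule double_schur_filter_tendsto_norm[OF assms(2)])
    fix \<phi> :: "ell1 \<Rightarrow>\<^sub>L real"
    show "((\<lambda>p. blinfun_apply \<phi> (x (fst p) - x (snd p))) \<longlongrightarrow> 0) (F \<times>\<^sub>F F)"
      \<comment> \<open>Both coordinates have the same limit, the value of the bidual element at the
        functional, so it cancels in the difference.\<close>
      using tendsto_diff[OF tendsto_fst_prod_filter[OF \<xi>[of \<phi>]] tendsto_snd_prod_filter[OF \<xi>[of \<phi>]]]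
      by (simp add: blinfun.diff_right)
  qed
  then obtain l where l: "(x \<longlongrightarrow> l) F"
    using tendsto_if_dist_prod_tendsto_0[OF F, of x] unfolding dist_norm by blast
  have "\<xi> = bidual_embed l"
  proof (rule blinfun_eqI)
    fix \<phi> :: "ell1 \<Rightarrow>\<^sub>L real"
    \<comment> \<open>Functionals are norm continuous; limits along the proper filter
      \<open>F\<close> are unique, so the two bidual elements agree at each functional.\<close>
    have "((\<lambda>n. blinfun_apply \<phi> (x n)) \<longlongrightarrow> blinfun_apply \<phi> l) F"
      by (intro tendsto_intros l)
    then show "blinfun_apply \<xi> \<phi> = blinfun_apply (bidual_embed l) \<phi>"
      using tendsto_unique[OF F \<xi>] by simp
  qed
  then show "\<xi> \<in> range bidual_embed"
    by simp
qed

theorem theorem5p8: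
  fixes N :: "'a set" and F :: "'a filter"
  assumes "countable N" and "infinite N"
    and "free_filter_on N F"
    and "double_schur_filter N F"
  shows "weak_ell1_complete_filter N F \<and> schur_filter N F"
  using double_schur_imp_weak_ell1_complete[OF _ assms(4)] double_schur_imp_schur[OF assms] assms(3)
  by (simp add: free_filter_on_def)

end
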